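(* Let $k\ge 1$ be an integer and let $G_k\in\mathbb{Q}[[y_1,\dots,y_k]]$ be the ordinary generating function $$G_k(y_1,\dots,y_k)=\sum_{i_1,\dots,i_k\ge 0}V(1^{i_1}\cdots k^{i_k})\,y_1^{i_1}\cdots y_k^{i_k}$$ of the numbers of vertices of Gelfand--Zetlin polytopes. Then $$\bigl(\Delta_1\Delta_2\cdots\Delta_k-(\Delta_1+\Delta_2)(\Delta_2+\Delta_3)\cdots(\Delta_{k-1}+\Delta_k)\bigr)G_k=0,$$ where $\Delta_i$ is the divided difference operator $\Delta_i(f)=\dfrac{f-f|_{y_i=0}}{y_i}$ on power series $f$ in $y_1,\dots,y_k$.
   Context: Let $\lambda_1\le\dots\le\lambda_n$ be a non-decreasing finite sequence of integers (called a partition). The Gelfand--Zetlin polytope $GZ(\lambda)$ is the convex polytope in $\mathbb{R}^{n(n-1)/2}$ with coordinates $u_{i,j}$ ($1\le i\le n-1$, $1\le j\le n-i$) defined by the inequalities $u_{i-1,j}\le u_{i,j}\le u_{i-1,j+1}$ for all such $i,j$, where $u_{0,j}:=\lambda_j$. For non-negative integers $i_1,\dots,i_k$ (some possibly zero), $1^{i_1}2^{i_2}\cdots k^{i_k}$ denotes the sequence consisting of $i_1$ copies of $1$, followed by $i_2$ copies of $2$, ..., $i_k$ copies of $k$. $V(p)$ denotes the number of vertices of $GZ(p)$; for the empty sequence $V=1$ (the polytope is a point). Products of operators mean compositions; for $k=1$ the empty product of operators is the identity. *)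

theory Defs
  imports
    "HOL-Analysis.Analysis"
    "HOL-Analysis.Finite_Function_Topology"
    "HOL-Library.Poly_Mapping"
    "HOL-Library.Function_Algebras"
begin

section \<open>Gelfand--Zetlin polytopes\<close>

text \<open>
  A partition is a list xs of integers, with lambda_j = xs ! (j - 1) and n = length xs.
  Since n varies, R^(n(n-1)/2) is realised as the space of finitely supported
  families of reals that vanish outside gz_indices n.
\<close>

definition gz_indices :: "nat \<Rightarrow> (nat \<times> nat) set" where
  "gz_indices n = {(i, j). 1 \<le> i \<and> i < n \<and> 1 \<le> j \<and> j \<le> n - i}"

definition gz_entry :: "int list \<Rightarrow> (nat \<times> nat \<Rightarrow>\<^sub>0 real) \<Rightarrow> nat \<Rightarrow> nat \<Rightarrow> real" where
  "gz_entry xs u i j =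
     (if i = 0 then of_int (xs ! (j - 1)) else Poly_Mapping.lookup u (i, j))"

definition GZ :: "int list \<Rightarrow> (nat \<times> nat \<Rightarrow>\<^sub>0 real) set" where
  "GZ xs = {u. Poly_Mapping.keys u \<subseteq> gz_indices (length xs) \<and>
     (\<forall>(i, j) \<in> gz_indices (length xs).
        gz_entry xs u (i - 1) j \<le> gz_entry xs u i j \<and>
        gz_entry xs u i j \<le> gz_entry xs u (i - 1) (j + 1))}"

definition V :: "int list \<Rightarrow> nat" where
  "V xs = card {v. v extreme_point_of GZ xs}"


section \<open>Power series\<close>

text \<open>
  A series is given by its coefficients, indexed by exponent vectors. The variables are
  y_1, y_2, \<dots>; the series in y_1, \<dots>, y_k are those in \<^term>\<open>ps_ring k\<close>.
  Sums, differences and zero, both of series and of operators on series, are the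
  pointwise ones of \<^theory>\<open>HOL-Library.Function_Algebras\<close>; the pointwise product of
  that theory is not used.
\<close>

type_synonym ps = "(nat \<Rightarrow>\<^sub>0 nat) \<Rightarrow> rat"

definition ps_ring :: "nat \<Rightarrow> ps set" where
  "ps_ring k = {f. \<forall>m. f m \<noteq> 0 \<longrightarrow> Poly_Mapping.keys m \<subseteq> {1..k}}"

definition ps_mult :: "ps \<Rightarrow> ps \<Rightarrow> ps" where
  "ps_mult f g = (\<lambda>m. \<Sum>(a, b) \<in> {(a, b). a + b = m}. f a * g b)"

definition ps_var :: "nat \<Rightarrow> ps" where
  "ps_var i = (\<lambda>m. if m = Poly_Mapping.single i 1 then 1 else 0)"

text \<open>The substitution y_i = 0 keeps exactly the terms not involving y_i.\<close>

definition ps_subst0 :: "nat \<Rightarrow> ps \<Rightarrow> ps" where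
  "ps_subst0 i f = (\<lambda>m. if Poly_Mapping.lookup m i = 0 then f m else 0)"

text \<open>The quotient by y_i exists and is unique; see \<open>ps_var_mult_Delta\<close> and \<open>Delta_unique\<close> below.\<close>

definition Delta :: "nat \<Rightarrow> ps \<Rightarrow> ps" where
  "Delta i f = (THE g. ps_mult (ps_var i) g = f - ps_subst0 i f)"

definition compose_list :: "(ps \<Rightarrow> ps) list \<Rightarrow> ps \<Rightarrow> ps" where
  "compose_list Ts = foldr (\<circ>) Ts id"


section \<open>The generating function\<close>

text \<open>The sequence of m_1 copies of 1, followed by m_2 copies of 2, up to m_k copies of k.\<close>

definition block_seq :: "nat \<Rightarrow> (nat \<Rightarrow>\<^sub>0 nat) \<Rightarrow> int list" where
  "block_seq k m = concat (map (\<lambda>j. replicate (Poly_Mapping.lookup m j) (int j)) [1..<k + 1])"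

definition G :: "nat \<Rightarrow> ps" where
  "G k = (\<lambda>m. if Poly_Mapping.keys m \<subseteq> {1..k} then of_nat (V (block_seq k m)) else 0)"


section \<open>Well-definedness of the divided difference\<close>

lemma finite_splittings: "finite {(a, b). a + b = (m :: nat \<Rightarrow>\<^sub>0 nat)}"
proof -
  let ?S = "{(a, b). a + b = m}"
  let ?K = "Poly_Mapping.keys m"
  let ?h = "\<lambda>(a, b :: nat \<Rightarrow>\<^sub>0 nat). restrict (Poly_Mapping.lookup a) ?K"
  have "?h ` ?S \<subseteq> (\<Pi>\<^sub>E x \<in> ?K. {..Poly_Mapping.lookup m x})"
    by (auto simp: lookup_add)
  moreover have "finite (\<Pi>\<^sub>E x \<in> ?K. {..Poly_Mapping.lookup m x})"
    by (intro finite_PiE) auto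
  ultimately have "finite (?h ` ?S)"
    by (rule finite_subset)
  moreover have "inj_on ?h ?S"
  proof (rule inj_onI, clarify)
    fix a b a' b'
    assume eq: "a' + b' = a + b" and m: "m = a + b"
      and r: "restrict (Poly_Mapping.lookup a) (Poly_Mapping.keys (a + b)) =
              restrict (Poly_Mapping.lookup a') (Poly_Mapping.keys (a + b))"
    have "a = a'"
    proof (rule poly_mapping_eqI)
      fix x
      have s: "Poly_Mapping.lookup a x + Poly_Mapping.lookup b x =
               Poly_Mapping.lookup a' x + Poly_Mapping.lookup b' x"
        by (metis eq lookup_add)
      show "Poly_Mapping.lookup a x = Poly_Mapping.lookup a' x"
      proof (cases "x \<in> Poly_Mapping.keys (a + b)")
        case True
        then show ?thesis using fun_cong[OF r, of x] by simp
      next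
        case False
        then show ?thesis using s by (simp add: in_keys_iff lookup_add)
      qed
    qed
    with eq show "a = a' \<and> b = b'" by simp
  qed
  ultimately show ?thesis by (simp add: finite_image_iff)
qed

lemma ps_var_mult_add: "ps_mult (ps_var i) g (Poly_Mapping.single i 1 + m) = g m"
proof -
  let ?s = "Poly_Mapping.single i (1 :: nat)"
  have "ps_mult (ps_var i) g (?s + m) =
      (\<Sum>p \<in> {(a, b). a + b = ?s + m}. if p = (?s, m) then g m else 0)"
    unfolding ps_mult_def by (intro sum.cong) (auto simp: ps_var_def split: if_splits)
  also have "\<dots> = g m"
    by (subst sum.delta[OF finite_splittings]) simp
  finally show ?thesis .
qed

lemma ps_var_mult_0:
  assumes "Poly_Mapping.lookup m i = 0"
  shows "ps_mult (ps_var i) g m = 0"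
proof -
  have "ps_var i a * g b = 0" if "a + b = m" for a b
  proof -
    have "Poly_Mapping.lookup a i = 0"
      using assms that by (auto simp: lookup_add)
    then have "a \<noteq> Poly_Mapping.single i 1"
      by (metis lookup_single_eq zero_neq_one)
    then show ?thesis by (simp add: ps_var_def)
  qed
  then show ?thesis unfolding ps_mult_def by (intro sum.neutral) auto
qed

lemma single_add_diff:
  assumes "Poly_Mapping.lookup m i \<noteq> (0 :: nat)"
  shows "\<exists>m'. m = Poly_Mapping.single i 1 + m'"
proof
  show "m = Poly_Mapping.single i 1 + (m - Poly_Mapping.single i 1)"
    by (rule poly_mapping_eqI) (use assms in \<open>auto simp: lookup_add lookup_minus lookup_single when_def\<close>)
qed

lemma ps_var_mult_eq_iff:
  "ps_mult (ps_var i) g = f - ps_subst0 i f \<longleftrightarrow>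
     g = (\<lambda>m. f (Poly_Mapping.single i 1 + m))"
proof
  assume *: "ps_mult (ps_var i) g = f - ps_subst0 i f"
  show "g = (\<lambda>m. f (Poly_Mapping.single i 1 + m))"
  proof
    fix m
    show "g m = f (Poly_Mapping.single i 1 + m)"
      using fun_cong[OF *, of "Poly_Mapping.single i 1 + m"] ps_var_mult_add[of i g m]
      by (simp add: ps_subst0_def lookup_add)
  qed
next
  assume g: "g = (\<lambda>m. f (Poly_Mapping.single i 1 + m))"
  show "ps_mult (ps_var i) g = f - ps_subst0 i f"
  proof
    fix m
    show "ps_mult (ps_var i) g m = (f - ps_subst0 i f) m"
    proof (cases "Poly_Mapping.lookup m i = 0")
      case True
      then show ?thesis by (simp add: ps_var_mult_0 ps_subst0_def)
    next
      case False
      then obtain m' where m': "m = Poly_Mapping.single i 1 + m'"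
        using single_add_diff[OF False] by (elim exE)
      have "ps_mult (ps_var i) g m = f m"
        unfolding m' ps_var_mult_add g by (rule refl)
      then show ?thesis
        using False by (simp add: ps_subst0_def)
    qed
  qed
qed

lemma Delta_coeff: "Delta i f = (\<lambda>m. f (Poly_Mapping.single i 1 + m))"
  unfolding Delta_def ps_var_mult_eq_iff by simp

lemma ps_var_mult_Delta: "ps_mult (ps_var i) (Delta i f) = f - ps_subst0 i f"
  by (simp add: ps_var_mult_eq_iff Delta_coeff)

lemma Delta_unique: "ps_mult (ps_var i) g = f - ps_subst0 i f \<Longrightarrow> g = Delta i f"
  by (simp add: ps_var_mult_eq_iff Delta_coeff)

lemma Delta_in_ps_ring:
  assumes "f \<in> ps_ring k"
  shows "Delta i f \<in> ps_ring k"
proof -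
  have "Poly_Mapping.keys m \<subseteq> {1..k}" if "f (Poly_Mapping.single i 1 + m) \<noteq> 0" for m
  proof -
    have "Poly_Mapping.keys m \<subseteq> Poly_Mapping.keys (Poly_Mapping.single i 1 + m)"
      by (auto simp: in_keys_iff lookup_add)
    also have "\<dots> \<subseteq> {1..k}"
      using assms that unfolding ps_ring_def by blast
    finally show ?thesis .
  qed
  then show ?thesis unfolding ps_ring_def Delta_coeff by blast
qed

lemma G_in_ps_ring: "G k \<in> ps_ring k"
  by (auto simp: G_def ps_ring_def)

end

(* A point of GZ(lambda) with lambda sorted is a vertex iff each entry equals one of the two
   entries above it. Hence V(lambda) is the sum of V(mu) over the distinct sequences mu with
   mu_j in {lambda_j, lambda_(j+1)}. If lambda = 1^(i_1+1) ... k^(i_k+1), such a mu is determined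
   by a choice of j or j+1 at each of the k-1 boundaries between blocks, and it equals
   1^(i_1) ... k^(i_k) enlarged by the chosen values. Since Delta_j shifts the coefficient
   sequence, this recurrence is the identity to be proved, coefficient by coefficient. *)

theory Submission
  imports Defs
begin

abbreviation lookup :: "('a \<Rightarrow>\<^sub>0 'b::zero) \<Rightarrow> 'a \<Rightarrow> 'b" where
  "lookup \<equiv> Poly_Mapping.lookup"

abbreviation keys :: "('a \<Rightarrow>\<^sub>0 'b::zero) \<Rightarrow> 'a set" where
  "keys \<equiv> Poly_Mapping.keys"

section \<open>Vertices of Gelfand--Zetlin polytopes\<close>

lemma mem_gz_indices: "(i, j) \<in> gz_indices n \<longleftrightarrow> 1 \<le> i \<and> 1 \<le> j \<and> i + j \<le> n"
  by (auto simp: gz_indices_def)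

lemma finite_gz_indices: "finite (gz_indices n)"
  by (rule finite_subset[of _ "{0..n} \<times> {0..n}"]) (auto simp: mem_gz_indices)

lemma gz_entry_0: "gz_entry xs u 0 j = of_int (xs ! (j - 1))"
  by (simp add: gz_entry_def)

lemma gz_entry_Suc: "gz_entry xs u (Suc i) j = lookup u (Suc i, j)"
  by (simp add: gz_entry_def)

text \<open>Shifting the row index by one removes the subtraction in \<open>i - 1\<close>, so that
  later proofs can induct on the row.\<close>

lemma GZ_iff:
  "u \<in> GZ xs \<longleftrightarrow> keys u \<subseteq> gz_indices (length xs) \<and>
     (\<forall>i j. 1 \<le> j \<and> Suc i + j \<le> length xs \<longrightarrow>
        gz_entry xs u i j \<le> gz_entry xs u (Suc i) j \<and>
        gz_entry xs u (Suc i) j \<le> gz_entry xs u i (Suc j))"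
proof -
  have "(\<forall>(i, j) \<in> gz_indices n. P (i - 1) i j) \<longleftrightarrow>
      (\<forall>i j. 1 \<le> j \<and> Suc i + j \<le> n \<longrightarrow> P i (Suc i) j)" for n P
  proof safe
    fix i j assume "\<forall>i j. 1 \<le> j \<and> Suc i + j \<le> n \<longrightarrow> P i (Suc i) j" "(i, j) \<in> gz_indices n"
    then show "P (i - 1) i j" by (cases i) (auto simp: mem_gz_indices)
  qed (force simp: mem_gz_indices)
  from this[of _ "\<lambda>i' i j. gz_entry xs u i' j \<le> gz_entry xs u i j \<and>
        gz_entry xs u i j \<le> gz_entry xs u i' (j + 1)"]
  show ?thesis by (simp add: GZ_def)
qed

text \<open>These turn out to be exactly the vertices of \<^term>\<open>GZ xs\<close> when \<^term>\<open>xs\<close> is sorted.\<close>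

definition gz_arrays :: "int list \<Rightarrow> (nat \<times> nat \<Rightarrow>\<^sub>0 real) set" where
  "gz_arrays xs = {u. keys u \<subseteq> gz_indices (length xs) \<and>
     (\<forall>i j. 1 \<le> j \<and> Suc i + j \<le> length xs \<longrightarrow>
        gz_entry xs u (Suc i) j \<in> {gz_entry xs u i j, gz_entry xs u i (Suc j)})}"

text \<open>Choosing one of two parents gives the interlacing inequalities only if the parents are
  in order. Sortedness of \<open>xs\<close> is therefore carried down row by row.\<close>

lemma gz_arrays_subset_GZ:
  assumes "sorted xs" and u: "u \<in> gz_arrays xs"
  shows "u \<in> GZ xs"
proof -
  let ?e = "gz_entry xs u" and ?n = "length xs"
  have step: "?e (Suc i) j \<in> {?e i j, ?e i (Suc j)}" if "1 \<le> j" "Suc i + j \<le> ?n" for i j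
    using u that by (auto simp: gz_arrays_def)
  have mono: "?e i j \<le> ?e i (Suc j)" if "1 \<le> j" "i + Suc j \<le> ?n" for i j
    using that
  proof (induction i arbitrary: j)
    case 0
    then show ?case using sorted_nth_mono[OF \<open>sorted xs\<close>, of "j - 1" j] by (simp add: gz_entry_0)
  next
    case (Suc i)
    \<comment> \<open>Neighbours in row \<open>Suc i\<close> share the parent at position
      \<open>Suc j\<close> of row \<open>i\<close>, which separates them.\<close>
    have "?e i j \<le> ?e i (Suc j)" "?e i (Suc j) \<le> ?e i (Suc (Suc j))"
      using Suc.prems by (auto intro!: Suc.IH)
    then show ?case
      using step[of j i] step[of "Suc j" i] Suc.prems by auto
  qed
  show ?thesis
    unfolding GZ_iff
  proof (intro conjI allI impI)
    show "keys u \<subseteq> gz_indices ?n" using u by (simp add: gz_arrays_def)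
  qed (use step mono in force)+
qed

section \<open>Segments in coordinates, and extremality of the choice arrays\<close>

lemma lookup_scaleR_poly_mapping:
  fixes u :: "'a \<Rightarrow>\<^sub>0 'b::real_vector"
  shows "lookup (r *\<^sub>R u) x = r *\<^sub>R lookup u x"
proof -
  have "finite {x. r *\<^sub>R lookup u x \<noteq> 0}"
    by (rule finite_subset[OF _ finite_keys[of u]]) (auto simp: in_keys_iff)
  then show ?thesis by (simp add: scaleR_poly_mapping_def lookup_Abs_poly_mapping)
qed

lemma gz_entry_convex_comb:
  assumes "v = (1 - t) *\<^sub>R a + t *\<^sub>R b"
  shows "gz_entry xs v i j = (1 - t) * gz_entry xs a i j + t * gz_entry xs b i j"
  by (simp add: gz_entry_def assms lookup_add lookup_scaleR_poly_mapping) (simp add: algebra_simps)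

text \<open>The deviations \<open>x - p\<close> and \<open>y - p\<close> are non-negative, and a sum
  of them with positive weights vanishes.\<close>

lemma convex_comb_eq_lower:
  fixes p x y t :: real
  assumes "p \<le> x" "p \<le> y" "0 < t" "t < 1" "p = (1 - t) * x + t * y"
  shows "x = p \<and> y = p"
proof -
  have "(1 - t) * (x - p) + t * (y - p) = 0" using assms(5) by (simp add: algebra_simps)
  moreover have "(1 - t) * (x - p) \<ge> 0" "t * (y - p) \<ge> 0" using assms by auto
  ultimately have "(1 - t) * (x - p) = 0" "t * (y - p) = 0" by linarith+
  then show ?thesis using assms by auto
qed

lemma convex_comb_eq_upper:
  fixes p x y t :: real
  assumes "x \<le> p" "y \<le> p" "0 < t" "t < 1" "p = (1 - t) * x + t * y"
  shows "x = p \<and> y = p"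
  using convex_comb_eq_lower[of "- p" "- x" "- y" t] assms by (simp add: algebra_simps)

text \<open>The ends of a segment through \<open>v\<close> agree with \<open>v\<close> row by row.
  Once the parents agree, both ends have their entry in the interval between the parents, and the
  entry of \<open>v\<close> is an endpoint of that interval.\<close>

lemma gz_arrays_extreme:
  assumes "sorted xs" and v: "v \<in> gz_arrays xs"
  shows "v extreme_point_of GZ xs"
  unfolding extreme_point_of_def
proof (intro conjI ballI notI)
  show "v \<in> GZ xs" using assms by (rule gz_arrays_subset_GZ)
  fix a b assume a: "a \<in> GZ xs" and b: "b \<in> GZ xs" and "v \<in> open_segment a b"
  then obtain t where "a \<noteq> b" and t: "0 < t" "t < 1" and vt: "v = (1 - t) *\<^sub>R a + t *\<^sub>R b"
    by (auto simp: in_segment)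
  let ?n = "length xs"
  have eq: "gz_entry xs a i j = gz_entry xs v i j \<and> gz_entry xs b i j = gz_entry xs v i j"
    if "1 \<le> j" "i + j \<le> ?n" for i j
    using that
  proof (induction i arbitrary: j)
    case 0
    then show ?case by (simp add: gz_entry_0)
  next
    case (Suc i)
    let ?p = "gz_entry xs v i j" and ?q = "gz_entry xs v i (Suc j)"
    have "?p \<le> gz_entry xs a (Suc i) j" "gz_entry xs a (Suc i) j \<le> ?q"
         "?p \<le> gz_entry xs b (Suc i) j" "gz_entry xs b (Suc i) j \<le> ?q"
      using a b Suc.IH[of j] Suc.IH[of "Suc j"] Suc.prems unfolding GZ_iff by fastforce+
    moreover have "gz_entry xs v (Suc i) j \<in> {?p, ?q}"
      using v Suc.prems by (auto simp: gz_arrays_def)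
    ultimately show ?case
      using convex_comb_eq_lower[OF _ _ t gz_entry_convex_comb[OF vt, of xs "Suc i" j]]
        convex_comb_eq_upper[OF _ _ t gz_entry_convex_comb[OF vt, of xs "Suc i" j]] by auto
  qed
  have "a = b"
  proof (rule poly_mapping_eqI)
    fix x :: "nat \<times> nat"
    obtain i j where x: "x = (i, j)" by (cases x)
    show "lookup a x = lookup b x"
    proof (cases "x \<in> gz_indices ?n")
      case True
      then show ?thesis using eq[of j i] by (auto simp: x mem_gz_indices gz_entry_def split: if_splits)
    next
      case False
      then show ?thesis using a b by (metis GZ_iff in_keys_iff subsetD)
    qed
  qed
  with \<open>a \<noteq> b\<close> show False ..
qed

text \<open>If an entry \<open>c\<close> in row \<open>i\<close> lies strictly between its two parents, then \<open>c\<close> does not occur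
  in the row above; hence all entries equal to \<open>c\<close> from row \<open>i\<close> on can be moved
  simultaneously in both directions.\<close>

lemma extreme_gz_arrays:
  assumes ext: "v extreme_point_of GZ xs"
  shows "v \<in> gz_arrays xs"
proof -
  let ?n = "length xs" and ?e = "gz_entry xs v"
  have vGZ: "v \<in> GZ xs" using ext by (simp add: extreme_point_of_def)
  then have kv: "keys v \<subseteq> gz_indices ?n" by (simp add: GZ_iff)
  have le: "?e i j \<le> ?e (Suc i) j" "?e (Suc i) j \<le> ?e i (Suc j)"
    if "1 \<le> j" "Suc i + j \<le> ?n" for i j
    using vGZ that by (auto simp: GZ_iff)
  have mono: "?e i j \<le> ?e i j'" if "1 \<le> j" "j \<le> j'" "i + j' \<le> ?n" for i j j'
    using that(2,3)
  proof (induction j' rule: dec_induct)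
    case (step m)
    then show ?case using le[of m i] \<open>1 \<le> j\<close> by fastforce
  qed simp
  have "?e (Suc i) j \<in> {?e i j, ?e i (Suc j)}" if ij: "1 \<le> j" "Suc i + j \<le> ?n" for i j
  proof (rule ccontr)
    assume not_parent: "\<not> ?thesis"
    define c where "c = ?e (Suc i) j"
    have "?e i j < c" "c < ?e i (Suc j)"
      using le[OF ij] not_parent by (auto simp: c_def)
    \<comment> \<open>By monotonicity, row \<open>i\<close> stays below \<open>c\<close> up to
      position \<open>j\<close> and above \<open>c\<close> from position \<open>Suc j\<close>
      on.\<close>
    then have row: "?e i q \<noteq> c" if "1 \<le> q" "i + q \<le> ?n" for q
      using mono[of q j i] mono[of "Suc j" q i] that ij by (cases "q \<le> j") auto
    define S where "S = {(p, q) \<in> gz_indices ?n. i < p \<and> lookup v (p, q) = c}"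
    have "finite S" by (rule finite_subset[OF _ finite_gz_indices[of ?n]]) (auto simp: S_def)
    \<comment> \<open>The number \<open>d\<close> bounds from below the gap between \<open>c\<close>
      and every other value, so entries equal to \<open>c\<close> that move by \<open>d\<close>
      never pass another value.\<close>
    have "finite ((\<lambda>(p, q). ?e p q) ` ({..?n} \<times> {..?n}))" by simp
    from finite_set_avoid[OF this, of c] obtain d
      where d: "d > 0" "\<And>p q. p \<le> ?n \<Longrightarrow> q \<le> ?n \<Longrightarrow> ?e p q \<noteq> c \<Longrightarrow> d \<le> \<bar>c - ?e p q\<bar>"
      by (fastforce simp: dist_real_def)
    define \<delta> where "\<delta> = Abs_poly_mapping (\<lambda>x. if x \<in> S then d else 0)"
    have lookup_\<delta>: "lookup \<delta> x = (if x \<in> S then d else 0)" for x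
      unfolding \<delta>_def using \<open>finite S\<close> by (subst lookup_Abs_poly_mapping) auto
    have move: "v + s *\<^sub>R \<delta> \<in> GZ xs" if s: "s = 1 \<or> s = -1" for s
    proof -
      let ?w = "v + s *\<^sub>R \<delta>"
      have w: "gz_entry xs ?w p q = ?e p q + (if (p, q) \<in> S then s * d else 0)" for p q
        by (auto simp: gz_entry_def lookup_add lookup_scaleR_poly_mapping lookup_\<delta> S_def)
      have S_iff: "(p, q) \<in> S \<longleftrightarrow> i < p \<and> ?e p q = c" if "1 \<le> q" "p + q \<le> ?n" for p q
        using that by (auto simp: S_def gz_entry_def mem_gz_indices)
      have sd: "\<bar>s * d\<bar> = d" using s d(1) by auto
      have aux: "gz_entry xs ?w p q \<le> gz_entry xs ?w p' q'"
        if "?e p q \<le> ?e p' q'" "1 \<le> q" "p + q \<le> ?n" "1 \<le> q'" "p' + q' \<le> ?n"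
          and adj: "p' = Suc p \<or> p = Suc p'" for p q p' q'
      proof (cases "(p, q) \<in> S \<longleftrightarrow> (p', q') \<in> S")
        case True
        then show ?thesis using that by (simp add: w)
      next
        case False
        \<comment> \<open>If the values were equal with just one index in \<open>S\<close>, both
          would be \<open>c\<close>, and the index outside \<open>S\<close> would lie in row
          \<open>i\<close>, where \<open>c\<close> does not occur.\<close>
        have "?e p q \<noteq> ?e p' q'"
        proof
          assume eq: "?e p q = ?e p' q'"
          then have "p = i \<or> p' = i" "?e p q = c"
            using False that by (auto simp: S_iff)
          then show False using row[of q] row[of q'] eq that by auto
        qed
        \<comment> \<open>Exactly one of the two values is \<open>c\<close>, and only that one
          moves.\<close>
        then have "d \<le> ?e p' q' - ?e p q"
          using False d(2)[of p q] d(2)[of p' q'] that by (auto simp: S_iff)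
        then show ?thesis using sd False by (auto simp: w abs_if split: if_splits)
      qed
      have "keys ?w \<subseteq> gz_indices ?n"
      proof
        fix x assume "x \<in> keys ?w"
        then have "x \<in> keys v \<or> x \<in> S" by (auto simp: in_keys_iff lookup_add lookup_scaleR_poly_mapping lookup_\<delta> split: if_splits)
        then show "x \<in> gz_indices ?n" using kv by (auto simp: S_def)
      qed
      then show ?thesis unfolding GZ_iff using le by (auto intro!: aux)
    qed
    have "lookup \<delta> (Suc i, j) = d"
      using ij by (simp add: lookup_\<delta> S_def mem_gz_indices c_def gz_entry_Suc)
    then have "\<delta> \<noteq> 0" using d(1) by auto
    \<comment> \<open>The two moved arrays have \<open>v\<close> as their midpoint.\<close>
    have "v \<in> open_segment (v + (-1) *\<^sub>R \<delta>) (v + 1 *\<^sub>R \<delta>)"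
      unfolding in_segment
    proof (intro conjI exI[of _ "1 / 2"])
      show "v + (-1) *\<^sub>R \<delta> \<noteq> v + 1 *\<^sub>R \<delta>"
      proof
        assume "v + (-1) *\<^sub>R \<delta> = v + 1 *\<^sub>R \<delta>"
        then have "(-1) *\<^sub>R \<delta> = 1 *\<^sub>R \<delta>" by (simp only: add_left_cancel)
        then show False using \<open>\<delta> \<noteq> 0\<close> by (simp only: scaleR_right_imp_eq scaleR_cancel_right) simp
      qed
      show "v = (1 - 1 / 2) *\<^sub>R (v + (-1) *\<^sub>R \<delta>) + (1 / 2) *\<^sub>R (v + 1 *\<^sub>R \<delta>)"
        by (rule poly_mapping_eqI) (simp only: lookup_add lookup_scaleR_poly_mapping, simp add: field_simps)
    qed auto
    then show False
      using ext move[of "-1"] move[of 1] unfolding extreme_point_of_def by blast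
  qed
  then show ?thesis using kv by (simp add: gz_arrays_def)
qed

lemma V_eq_card_gz_arrays: "sorted xs \<Longrightarrow> V xs = card (gz_arrays xs)"
  unfolding V_def
  by (intro arg_cong[where f = card] Collect_eqI[THEN trans[OF _ Collect_mem_eq]])
     (blast intro: gz_arrays_extreme extreme_gz_arrays)

section \<open>Removing the top row\<close>

text \<open>The possible first rows \<open>u\<^sub>1\<^sub>,\<^sub>1, u\<^sub>1\<^sub>,\<^sub>2, \<dots>\<close> of the members of \<^const>\<open>gz_arrays\<close>.\<close>

fun next_rows :: "'a list \<Rightarrow> 'a list set" where
  "next_rows [] = {}"
| "next_rows [x] = {[]}"
| "next_rows (x # y # zs) = (\<lambda>(c, ys). c # ys) ` ({x, y} \<times> next_rows (y # zs))"

lemma finite_next_rows: "finite (next_rows xs)"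
  by (induction xs rule: next_rows.induct) auto

lemma mem_next_rows_iff:
  assumes "xs \<noteq> []"
  shows "ys \<in> next_rows xs \<longleftrightarrow> Suc (length ys) = length xs \<and>
    (\<forall>j < length ys. ys ! j \<in> {xs ! j, xs ! Suc j})"
  using assms
proof (induction xs arbitrary: ys rule: next_rows.induct)
  case (3 x y zs)
  then show ?case by (cases ys) (auto simp: All_less_Suc2)
qed auto

text \<open>The entry \<open>xs ! Suc j\<close> is a parent of both \<open>ys ! j\<close> and
  \<open>ys ! Suc j\<close> and separates them.\<close>

lemma sorted_next_rows:
  assumes "sorted xs" "ys \<in> next_rows xs"
  shows "sorted ys"
proof -
  have "xs \<noteq> []" using assms by auto
  note ys = assms(2)[unfolded mem_next_rows_iff[OF this]]
  show ?thesis unfolding sorted_iff_nth_Suc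
  proof (intro allI impI)
    fix j assume "Suc j < length ys"
    then have "ys ! j \<in> {xs ! j, xs ! Suc j}" "ys ! Suc j \<in> {xs ! Suc j, xs ! Suc (Suc j)}"
      "xs ! j \<le> xs ! Suc j" "xs ! Suc j \<le> xs ! Suc (Suc j)"
      using ys assms(1) by (auto simp: sorted_iff_nth_Suc)
    then have "ys ! j \<le> xs ! Suc j" "xs ! Suc j \<le> ys ! Suc j" by auto
    then show "ys ! j \<le> ys ! Suc j" by simp
  qed
qed

text \<open>Row 0 of an array is read from the list and not stored in \<open>u\<close>. Putting a
  new list on top therefore means storing \<open>ys\<close> as row 1 and moving the rows of
  \<open>u\<close> down by one.\<close>

definition gz_cons :: "int list \<Rightarrow> (nat \<times> nat \<Rightarrow>\<^sub>0 real) \<Rightarrow> (nat \<times> nat \<Rightarrow>\<^sub>0 real)" where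
  "gz_cons ys u = Abs_poly_mapping (\<lambda>(i, j). if i = 0 then 0 else if i = 1
     then (if 1 \<le> j \<and> j \<le> length ys then of_int (ys ! (j - 1)) else 0) else lookup u (i - 1, j))"

lemma lookup_gz_cons:
  "lookup (gz_cons ys u) (i, j) = (if i = 0 then 0 else if i = 1
     then (if 1 \<le> j \<and> j \<le> length ys then of_int (ys ! (j - 1)) else 0) else lookup u (i - 1, j))"
proof -
  let ?f = "\<lambda>(i, j). if i = 0 then 0 else if i = 1
     then (if 1 \<le> j \<and> j \<le> length ys then real_of_int (ys ! (j - 1)) else 0) else lookup u (i - 1, j)"
  have "{x. ?f x \<noteq> 0} \<subseteq> {1} \<times> {1..length ys} \<union> (\<lambda>(i, j). (Suc i, j)) ` keys u"
  proof
    fix x assume x: "x \<in> {x. ?f x \<noteq> 0}"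
    obtain i j where ij: "x = (i, j)" by (cases x)
    show "x \<in> {1} \<times> {1..length ys} \<union> (\<lambda>(i, j). (Suc i, j)) ` keys u"
    proof (cases "i \<le> 1")
      case True
      with x show ?thesis by (auto simp: ij split: if_splits)
    next
      case False
      with x have "(i - 1, j) \<in> keys u" "x = (\<lambda>(i, j). (Suc i, j)) (i - 1, j)"
        by (auto simp: ij in_keys_iff)
      then show ?thesis by blast
    qed
  qed
  then have "finite {x. ?f x \<noteq> 0}" by (rule finite_subset) simp
  then show ?thesis unfolding gz_cons_def by (subst lookup_Abs_poly_mapping) auto
qed

text \<open>The case \<open>i = 0\<close> is included, so a single shift transfers the parent
  condition between the two arrays.\<close>

lemma gz_entry_gz_cons:
  assumes "1 \<le> j" "i + j \<le> length ys"
  shows "gz_entry xs (gz_cons ys u) (Suc i) j = gz_entry ys u i j"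
  using assms by (simp add: gz_entry_def lookup_gz_cons)

lemma gz_cons_in_gz_arrays:
  assumes "ys \<in> next_rows xs" "u \<in> gz_arrays ys"
  shows "gz_cons ys u \<in> gz_arrays xs"
proof -
  have "xs \<noteq> []" using assms by auto
  note ys = assms(1)[unfolded mem_next_rows_iff[OF this]]
  have "keys (gz_cons ys u) \<subseteq> gz_indices (length xs)"
  proof clarify
    fix i j assume *: "(i, j) \<in> keys (gz_cons ys u)"
    show "(i, j) \<in> gz_indices (length xs)"
    proof (cases "i \<le> 1")
      case True
      with * ys show ?thesis
        by (auto simp: in_keys_iff lookup_gz_cons mem_gz_indices split: if_splits)
    next
      case False
      with * have "(i - 1, j) \<in> keys u" by (auto simp: in_keys_iff lookup_gz_cons)
      then have "(i - 1, j) \<in> gz_indices (length ys)" using assms(2) by (auto simp: gz_arrays_def)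
      then show ?thesis using ys False by (auto simp: mem_gz_indices)
    qed
  qed
  moreover have "gz_entry xs (gz_cons ys u) (Suc i) j \<in>
      {gz_entry xs (gz_cons ys u) i j, gz_entry xs (gz_cons ys u) i (Suc j)}"
    if "1 \<le> j" "Suc i + j \<le> length xs" for i j
  proof (cases i)
    case 0
    then show ?thesis using that ys spec[OF conjunct2[OF ys], of "j - 1"]
      by (auto simp: gz_entry_gz_cons gz_entry_0)
  next
    case (Suc i')
    then have "gz_entry ys u (Suc i') j \<in> {gz_entry ys u i' j, gz_entry ys u i' (Suc j)}"
      using assms(2) that ys by (auto simp: gz_arrays_def)
    then show ?thesis using Suc that ys by (simp add: gz_entry_gz_cons)
  qed
  ultimately show ?thesis by (simp add: gz_arrays_def)
qed

lemma inj_on_gz_cons: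
  "inj_on (\<lambda>(ys, u). gz_cons ys u) (SIGMA ys : next_rows xs. gz_arrays ys)"
proof (rule inj_onI, clarify)
  fix ys u zs w
  assume ys: "ys \<in> next_rows xs" and zs: "zs \<in> next_rows xs"
    and u: "u \<in> gz_arrays ys" and w: "w \<in> gz_arrays zs"
    and eq: "gz_cons ys u = gz_cons zs w"
  have "xs \<noteq> []" using ys by auto
  then have len: "length ys = length zs" using ys zs by (simp add: mem_next_rows_iff)
  have "ys = zs"
  proof (rule nth_equalityI[OF len])
    fix j assume "j < length ys"
    then show "ys ! j = zs ! j"
      using arg_cong[OF eq, of "\<lambda>p. lookup p (1, Suc j)"] len by (simp add: lookup_gz_cons)
  qed
  moreover have "u = w"
  proof (rule poly_mapping_eqI)
    fix x :: "nat \<times> nat"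
    obtain i j where x: "x = (i, j)" by (cases x)
    show "lookup u x = lookup w x"
    proof (cases i)
      case 0
      \<comment> \<open>\<open>gz_cons\<close> forgets row 0 of \<open>u\<close> and
        \<open>w\<close>, but both vanish there.\<close>
      then have "x \<notin> keys u" "x \<notin> keys w"
        using u w by (auto simp: x gz_arrays_def mem_gz_indices)
      then show ?thesis by (simp add: in_keys_iff)
    next
      case (Suc i')
      then show ?thesis
        using arg_cong[OF eq, of "\<lambda>p. lookup p (Suc i, j)"] by (simp add: x lookup_gz_cons)
    qed
  qed
  ultimately show "ys = zs \<and> u = w" ..
qed

lemma gz_arrays_subset_gz_cons:
  assumes "xs \<noteq> []" "v \<in> gz_arrays xs"
  shows "v \<in> (\<lambda>(ys, u). gz_cons ys u) ` (SIGMA ys : next_rows xs. gz_arrays ys)"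
proof -
  let ?n = "length xs"
  \<comment> \<open>Entries of row 1 are copies of entries of \<open>xs\<close>, hence integers, and
    the floor loses nothing.\<close>
  define ys where "ys = map (\<lambda>j. \<lfloor>lookup v (1, j)\<rfloor>) [1..<?n]"
  \<comment> \<open>Row 1 of \<open>v\<close> becomes the list \<open>ys\<close>; it must not be
    stored again in row 0, which lies outside \<open>gz_indices\<close>.\<close>
  define u where "u = Abs_poly_mapping (\<lambda>(i, j). if i = 0 then 0 else lookup v (Suc i, j))"
  have v: "gz_entry xs v (Suc i) j \<in> {gz_entry xs v i j, gz_entry xs v i (Suc j)}"
    if "1 \<le> j" "Suc i + j \<le> ?n" for i j
    using assms(2) that by (auto simp: gz_arrays_def)
  have kv: "keys v \<subseteq> gz_indices ?n" using assms(2) by (simp add: gz_arrays_def)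
  have "finite {x. (\<lambda>(i, j). if i = 0 then 0 else lookup v (Suc i, j)) x \<noteq> 0}"
  proof (rule finite_subset)
    show "{x. (\<lambda>(i, j). if i = 0 then 0 else lookup v (Suc i, j)) x \<noteq> 0}
        \<subseteq> (\<lambda>(i, j). (i - 1, j)) ` keys v"
      by (force simp: in_keys_iff split: if_splits)
  qed simp
  then have lookup_u: "lookup u (i, j) = (if i = 0 then 0 else lookup v (Suc i, j))" for i j
    unfolding u_def by (subst lookup_Abs_poly_mapping) auto
  have len: "Suc (length ys) = ?n" using assms(1) by (simp add: ys_def Suc_leI)
  have row1: "lookup v (1, j) \<in> {of_int (xs ! (j - 1)), of_int (xs ! j)}"
    if "1 \<le> j" "Suc j \<le> ?n" for j
    using v[of j 0] that by (simp add: gz_entry_def)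
  have ys_nth: "ys ! (j - 1) \<in> {xs ! (j - 1), xs ! j}" "of_int (ys ! (j - 1)) = lookup v (1, j)"
    if "1 \<le> j" "Suc j \<le> ?n" for j
    using row1[OF that] that by (auto simp: ys_def)
  have "ys \<in> next_rows xs"
    unfolding mem_next_rows_iff[OF assms(1)] using len ys_nth(1)[of "Suc j" for j] by auto
  moreover have veq: "v = gz_cons ys u"
  proof (rule poly_mapping_eqI)
    fix x :: "nat \<times> nat"
    obtain i j where x: "x = (i, j)" by (cases x)
    have zero: "lookup v (i, j) = 0" if "(i, j) \<notin> gz_indices ?n"
      using kv that by (auto simp: in_keys_iff)
    consider "i = 0" | "i = 1" | "i > 1" by linarith
    then show "lookup v x = lookup (gz_cons ys u) x"
    proof cases
      case 2
      then show ?thesis using zero ys_nth(2)[of j] len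
        by (auto simp: x lookup_gz_cons mem_gz_indices)
    qed (use zero in \<open>auto simp: x lookup_gz_cons lookup_u mem_gz_indices\<close>)
  qed
  moreover have "u \<in> gz_arrays ys"
  proof -
    have "keys u \<subseteq> gz_indices (length ys)"
    proof clarify
      fix i j assume "(i, j) \<in> keys u"
      then have "i \<noteq> 0" "(Suc i, j) \<in> keys v" by (auto simp: in_keys_iff lookup_u split: if_splits)
      then show "(i, j) \<in> gz_indices (length ys)" using kv len by (auto simp: mem_gz_indices)
    qed
    moreover have "gz_entry ys u (Suc i) j \<in> {gz_entry ys u i j, gz_entry ys u i (Suc j)}"
      if "1 \<le> j" "Suc i + j \<le> length ys" for i j
      using v[of j "Suc i"] that len by (simp add: veq gz_entry_gz_cons)
    ultimately show ?thesis by (simp add: gz_arrays_def)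
  qed
  ultimately show ?thesis by force
qed

lemma bij_betw_gz_cons:
  assumes "xs \<noteq> []"
  shows "bij_betw (\<lambda>(ys, u). gz_cons ys u) (SIGMA ys : next_rows xs. gz_arrays ys) (gz_arrays xs)"
  unfolding bij_betw_def
  using inj_on_gz_cons gz_cons_in_gz_arrays gz_arrays_subset_gz_cons[OF assms] by fast

lemma finite_gz_arrays: "finite (gz_arrays xs)"
proof (induction xs rule: length_induct)
  case (1 xs)
  show ?case
  proof (cases "xs = []")
    case True
    then have "gz_arrays xs \<subseteq> {0}" by (auto simp: gz_arrays_def gz_indices_def)
    then show ?thesis by (rule finite_subset) simp
  next
    case False
    have "finite (gz_arrays ys)" if "ys \<in> next_rows xs" for ys
      using 1 that False by (auto simp: mem_next_rows_iff)
    then have "finite (SIGMA ys : next_rows xs. gz_arrays ys)"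
      by (intro finite_SigmaI finite_next_rows)
    then show ?thesis using bij_betw_finite[OF bij_betw_gz_cons[OF False]] by simp
  qed
qed

text \<open>Arrays are counted by their first row, which is again sorted, so that \<open>V\<close>
  counts the arrays below it too. The empty list is excluded: there \<open>V\<close> is 1 but the
  sum is empty.\<close>

lemma V_eq_sum_next_rows:
  assumes "sorted xs" "xs \<noteq> []"
  shows "V xs = (\<Sum>ys \<in> next_rows xs. V ys)"
proof -
  have "V xs = card (SIGMA ys : next_rows xs. gz_arrays ys)"
    using V_eq_card_gz_arrays[OF assms(1)] bij_betw_same_card[OF bij_betw_gz_cons[OF assms(2)]] by simp
  also have "\<dots> = (\<Sum>ys \<in> next_rows xs. card (gz_arrays ys))"
    by (simp add: card_SigmaI finite_next_rows finite_gz_arrays)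
  also have "\<dots> = (\<Sum>ys \<in> next_rows xs. V ys)"
    using sorted_next_rows[OF assms(1)] by (intro sum.cong) (auto simp: V_eq_card_gz_arrays)
  finally show ?thesis .
qed

section \<open>First rows of sequences made of blocks\<close>

lemma sum_next_rows_Cons:
  "(\<Sum>ys \<in> next_rows (x # y # zs). F ys) = (\<Sum>c \<in> {x, y}. \<Sum>ys \<in> next_rows (y # zs). F (c # ys))"
  unfolding next_rows.simps
  by (subst sum.reindex) (auto simp: inj_on_def sum.cartesian_product intro!: sum.cong)

lemma next_rows_replicate: "next_rows (replicate (Suc a) x) = {replicate a x}"
  by (induction a) auto

text \<open>Inside a block both parents coincide, so the only choice is at the boundary: keep one
  more \<open>x\<close> or take \<open>y\<close>. Since \<open>x\<close> and \<open>y\<close>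
  differ, these choices give two separate terms of the sum.\<close>

lemma sum_next_rows_replicate:
  assumes "x \<noteq> y"
  shows "(\<Sum>ys \<in> next_rows (replicate (Suc a) x @ y # zs). F ys) =
     (\<Sum>ys \<in> next_rows (y # zs). F (replicate (Suc a) x @ ys)) +
     (\<Sum>ys \<in> next_rows (y # zs). F (replicate a x @ y # ys))"
proof (induction a arbitrary: F)
  case 0
  then show ?case using assms by (simp add: sum_next_rows_Cons del: next_rows.simps)
next
  case (Suc a)
  have "(\<Sum>ys \<in> next_rows (replicate (Suc (Suc a)) x @ y # zs). F ys) =
      (\<Sum>ys \<in> next_rows (replicate (Suc a) x @ y # zs). F (x # ys))"
    by (simp add: sum_next_rows_Cons del: next_rows.simps)
  then show ?case using Suc.IH[of "\<lambda>ys. F (x # ys)"] by simp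
qed

section \<open>Compositions of divided differences\<close>

lemma compose_list_Nil: "compose_list [] f = f"
  by (simp add: compose_list_def)

lemma compose_list_Cons: "compose_list (T # Ts) f = T (compose_list Ts f)"
  by (simp add: compose_list_def)

lemma Delta_apply: "Delta i f m = f (Poly_Mapping.single i 1 + m)"
  by (simp add: Delta_coeff)

lemma compose_Delta:
  "compose_list (map Delta is) f m = f (m + (\<Sum>i \<leftarrow> is. Poly_Mapping.single i 1))"
  by (induction "is" arbitrary: m) (simp_all add: compose_list_Nil compose_list_Cons Delta_apply ac_simps)

text \<open>The second product of the theorem over an arbitrary index list, so that an induction can
  peel off its first factor.\<close>

definition pair_Deltas :: "nat list \<Rightarrow> ps \<Rightarrow> ps" where
  "pair_Deltas is = compose_list (map (\<lambda>i. Delta i + Delta (i + 1)) is)"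

lemma pair_Deltas_Nil: "pair_Deltas [] f = f"
  by (simp add: pair_Deltas_def compose_list_Nil)

lemma pair_Deltas_Cons:
  "pair_Deltas (i # is) f m =
     pair_Deltas is f (Poly_Mapping.single i 1 + m) + pair_Deltas is f (Poly_Mapping.single (Suc i) 1 + m)"
  by (simp add: pair_Deltas_def compose_list_Cons Delta_apply)

text \<open>The operator is a sum of coefficient shifts and so commutes with translation of the
  exponent vector.\<close>

lemma pair_Deltas_shift: "pair_Deltas is f (a + m) = pair_Deltas is (\<lambda>m'. f (a + m')) m"
proof (induction "is" arbitrary: m)
  case (Cons i "is")
  show ?case using Cons.IH[of "Poly_Mapping.single i 1 + m"] Cons.IH[of "Poly_Mapping.single (Suc i) 1 + m"]
    by (simp add: pair_Deltas_Cons add.left_commute[of a])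
qed (simp add: pair_Deltas_Nil)

text \<open>Locality: the operator moves the exponent vector only in coordinates from \<^term>\<open>S\<close>.\<close>

lemma pair_Deltas_cong:
  assumes "set is \<union> Suc ` set is \<subseteq> S"
    and "\<And>m'. (\<And>x. x \<notin> S \<Longrightarrow> lookup m' x = lookup m x) \<Longrightarrow> f m' = g m'"
  shows "pair_Deltas is f m = pair_Deltas is g m"
  using assms
proof (induction "is" arbitrary: m)
  case (Cons i "is")
  have "pair_Deltas is f (Poly_Mapping.single j 1 + m) = pair_Deltas is g (Poly_Mapping.single j 1 + m)"
    if "j \<in> S" for j
  proof (rule Cons.IH)
    fix m' assume *: "\<And>x. x \<notin> S \<Longrightarrow> lookup m' x = lookup (Poly_Mapping.single j 1 + m) x"
    show "f m' = g m'"
    proof (rule Cons.prems(2))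
      fix x assume "x \<notin> S"
      then show "lookup m' x = lookup m x"
        using * that by (metis add_0 lookup_add lookup_single_not_eq)
    qed
  qed (use Cons.prems in auto)
  then show ?case using Cons.prems(1) by (simp add: pair_Deltas_Cons)
qed (simp add: pair_Deltas_Nil)

section \<open>The generating function\<close>

text \<open>Unlike \<open>block_seq\<close>, this allows tails of the index range and multiplicities
  without finite support, such as \<open>\<lambda>j. Suc (lookup m j)\<close>.\<close>

definition blocks :: "(nat \<Rightarrow> nat) \<Rightarrow> nat list \<Rightarrow> int list" where
  "blocks p js = concat (map (\<lambda>j. replicate (p j) (int j)) js)"

lemma blocks_Cons: "blocks p (j # js) = replicate (p j) (int j) @ blocks p js"
  by (simp add: blocks_def)

lemma blocks_cong: "(\<And>j. j \<in> set js \<Longrightarrow> p j = q j) \<Longrightarrow> blocks p js = blocks q js"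
  unfolding blocks_def by (simp cong: map_cong)

lemma block_seq_blocks: "block_seq k m = blocks (lookup m) [1..<k + 1]"
  by (simp add: block_seq_def blocks_def)

lemma sorted_blocks: "sorted (blocks p [l..<r])"
proof (induction r)
  case (Suc r)
  then show ?case by (auto simp: blocks_def sorted_append)
qed (simp add: blocks_def)

text \<open>Downward induction on \<open>l\<close>, splitting off the first block. At the boundary
  after it, keeping \<open>l\<close> corresponds to \<open>Delta l\<close> and taking
  \<open>Suc l\<close> to \<open>Delta (Suc l)\<close>. The function \<open>F\<close> is arbitrary
  because the split-off prefix is absorbed into it.\<close>

lemma sum_next_rows_blocks:
  assumes "l \<le> k"
  shows "(\<Sum>ys \<in> next_rows (blocks (\<lambda>j. Suc (lookup m j)) [l..<Suc k]). F ys) =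
    pair_Deltas [l..<k] (\<lambda>m'. F (blocks (lookup m') [l..<Suc k])) m"
  using assms
proof (induction l arbitrary: F rule: inc_induct)
  case base
  \<comment> \<open>A single block with \<open>lookup m k + 1\<close> copies has one next row, with
    one copy fewer, and the operator product is empty.\<close>
  show ?case
    by (simp add: blocks_def pair_Deltas_Nil next_rows_replicate del: replicate_Suc)
next
  case (step l)
  let ?l = "Suc l"
  let ?B = "\<lambda>p. blocks p [?l..<Suc k]"
  let ?N = "next_rows (?B (\<lambda>j. Suc (lookup m j)))"
  have up: "[l..<Suc k] = l # [?l..<Suc k]" "[?l..<Suc k] = ?l # [Suc ?l..<Suc k]"
    "[l..<k] = l # [?l..<k]"
    using step.hyps by (simp_all add: upt_conv_Cons del: upt_Suc)
  \<comment> \<open>The multiplicity of \<open>Suc l\<close> is a successor, so its block is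
    nonempty and follows the block of \<open>l\<close> directly.\<close>
  obtain zs where zs: "?B (\<lambda>j. Suc (lookup m j)) = int ?l # zs"
    unfolding up(2) blocks_Cons by simp
  have "(\<Sum>ys \<in> next_rows (blocks (\<lambda>j. Suc (lookup m j)) [l..<Suc k]). F ys) =
      (\<Sum>ys \<in> ?N. F (replicate (Suc (lookup m l)) (int l) @ ys)) +
      (\<Sum>ys \<in> ?N. F (replicate (lookup m l) (int l) @ int ?l # ys))"
    unfolding up(1) blocks_Cons zs by (rule sum_next_rows_replicate) simp
  also have "(\<Sum>ys \<in> ?N. F (replicate (Suc (lookup m l)) (int l) @ ys)) =
      pair_Deltas [?l..<k] (\<lambda>m'. F (replicate (Suc (lookup m l)) (int l) @ ?B (lookup m'))) m"
    by (rule step.IH)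
  also have "\<dots> = pair_Deltas [?l..<k]
      (\<lambda>m'. F (blocks (lookup (Poly_Mapping.single l 1 + m')) [l..<Suc k])) m"
  \<comment> \<open>The remaining factors move only coordinates above \<open>l\<close>, so
    \<open>m'\<close> still has the multiplicity of \<open>m\<close> at \<open>l\<close>, and the
    kept copy is a unit shift there.\<close>
  proof (rule pair_Deltas_cong[where S = "{?l..}"])
    fix m' assume "\<And>x. x \<notin> {?l..} \<Longrightarrow> lookup m' x = lookup m x"
    then have "lookup m' l = lookup m l" by simp
    moreover have "?B (lookup (Poly_Mapping.single l 1 + m')) = ?B (lookup m')"
      by (rule blocks_cong) (auto simp: lookup_add lookup_single)
    ultimately show "F (replicate (Suc (lookup m l)) (int l) @ ?B (lookup m')) =
        F (blocks (lookup (Poly_Mapping.single l 1 + m')) [l..<Suc k])"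
      unfolding up(1) blocks_Cons by (simp add: lookup_add)
  qed auto
  also have "\<dots> = pair_Deltas [?l..<k] (\<lambda>m'. F (blocks (lookup m') [l..<Suc k])) (Poly_Mapping.single l 1 + m)"
    by (rule pair_Deltas_shift[symmetric])
  also have "(\<Sum>ys \<in> ?N. F (replicate (lookup m l) (int l) @ int ?l # ys)) =
      pair_Deltas [?l..<k] (\<lambda>m'. F (replicate (lookup m l) (int l) @ int ?l # ?B (lookup m'))) m"
    by (rule step.IH)
  also have "\<dots> = pair_Deltas [?l..<k]
      (\<lambda>m'. F (blocks (lookup (Poly_Mapping.single ?l 1 + m')) [l..<Suc k])) m"
  \<comment> \<open>Here the chosen \<open>Suc l\<close> joins the front of the next block, which is
    a unit shift at \<open>Suc l\<close>.\<close>
  proof (rule pair_Deltas_cong[where S = "{?l..}"])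
    fix m' assume "\<And>x. x \<notin> {?l..} \<Longrightarrow> lookup m' x = lookup m x"
    then have "lookup m' l = lookup m l" by simp
    moreover have "?B (lookup (Poly_Mapping.single ?l 1 + m')) = int ?l # ?B (lookup m')"
    proof -
      have "blocks (lookup (Poly_Mapping.single ?l 1 + m')) [Suc ?l..<Suc k] =
          blocks (lookup m') [Suc ?l..<Suc k]"
        by (rule blocks_cong) (auto simp: lookup_add lookup_single)
      then show ?thesis unfolding up(2) blocks_Cons by (simp add: lookup_add)
    qed
    ultimately show "F (replicate (lookup m l) (int l) @ int ?l # ?B (lookup m')) =
        F (blocks (lookup (Poly_Mapping.single ?l 1 + m')) [l..<Suc k])"
      unfolding up(1) blocks_Cons by (simp add: lookup_add lookup_single)
  qed auto
  also have "\<dots> = pair_Deltas [?l..<k] (\<lambda>m'. F (blocks (lookup m') [l..<Suc k])) (Poly_Mapping.single ?l 1 + m)"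
    by (rule pair_Deltas_shift[symmetric])
  finally show ?case unfolding up(3) pair_Deltas_Cons .
qed

lemma V_blocks_Suc:
  assumes "1 \<le> k"
  shows "of_nat (V (blocks (\<lambda>j. Suc (lookup m j)) [1..<Suc k])) =
    pair_Deltas [1..<k] (\<lambda>m'. of_nat (V (block_seq k m'))) m"
proof -
  let ?xs = "blocks (\<lambda>j. Suc (lookup m j)) [1..<Suc k]"
  have "?xs \<noteq> []"
    using assms by (simp add: upt_conv_Cons blocks_Cons del: upt_Suc)
  then have "of_nat (V ?xs) = (\<Sum>ys \<in> next_rows ?xs. (of_nat (V ys) :: rat))"
    by (simp add: V_eq_sum_next_rows sorted_blocks del: upt_Suc)
  also have "\<dots> = pair_Deltas [1..<k] (\<lambda>m'. of_nat (V (block_seq k m'))) m"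
    by (subst sum_next_rows_blocks[OF assms]) (simp add: block_seq_blocks)
  finally show ?thesis .
qed

lemma lookup_sum_list_single:
  assumes "distinct is"
  shows "lookup (\<Sum>i \<leftarrow> is. Poly_Mapping.single i (1 :: nat)) x = (if x \<in> set is then 1 else 0)"
  using assms by (induction "is") (auto simp: lookup_add lookup_single when_def)

theorem theorem1p2:
  fixes k :: nat
  assumes "1 \<le> k"
  shows "(compose_list (map Delta [1..<k + 1])
          - compose_list (map (\<lambda>i. Delta i + Delta (i + 1)) [1..<k])) (G k) = 0"
proof
  fix m :: "nat \<Rightarrow>\<^sub>0 nat"
  \<comment> \<open>The full product of the \<open>Delta\<close> operators reads the coefficient at
    \<open>m1\<close>, where each of the \<open>k\<close> multiplicities is one larger.\<close>
  define m1 where "m1 = m + (\<Sum>i \<leftarrow> [1..<k + 1]. Poly_Mapping.single i 1)"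
  have m1: "lookup m1 x = lookup m x + (if x \<in> {1..k} then 1 else 0)" for x
    by (simp add: m1_def lookup_add lookup_sum_list_single del: upt_Suc One_nat_def)
  have lhs: "compose_list (map Delta [1..<k + 1]) (G k) m = G k m1"
    by (simp add: compose_Delta m1_def del: upt_Suc)
  have keys_iff: "keys m' \<subseteq> {1..k} \<longleftrightarrow> (\<forall>x. x \<notin> {1..k} \<longrightarrow> lookup m' x = 0)" for m' :: "nat \<Rightarrow>\<^sub>0 nat"
    by (auto simp: in_keys_iff)
  have "G k m1 = pair_Deltas [1..<k] (G k) m"
  proof (cases "keys m \<subseteq> {1..k}")
    case True
    then have "G k m1 = of_nat (V (block_seq k m1))"
      by (auto simp: G_def keys_iff m1 simp del: One_nat_def)
    also have "block_seq k m1 = blocks (\<lambda>j. Suc (lookup m j)) [1..<Suc k]"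
      \<comment> \<open>The two multiplicity functions differ outside \<open>1..k\<close>, but
        \<open>blocks\<close> reads only indices in that range.\<close>
      unfolding block_seq_blocks Suc_eq_plus1 by (rule blocks_cong) (auto simp: m1)
    also have "of_nat (V \<dots>) = pair_Deltas [1..<k] (\<lambda>m'. of_nat (V (block_seq k m'))) m"
      using assms by (rule V_blocks_Suc)
    also have "\<dots> = pair_Deltas [1..<k] (G k) m"
      \<comment> \<open>All exponent vectors reached from \<open>m\<close> keep their support in
        \<open>{1..k}\<close>, where \<open>G\<close> is given by \<open>V\<close>.\<close>
      by (rule pair_Deltas_cong[where S = "{1..k}"]) (use True in \<open>auto simp: G_def keys_iff simp del: One_nat_def\<close>)
    finally show ?thesis .
  next
    case False
    \<comment> \<open>Some coordinate of \<open>m\<close> outside \<open>{1..k}\<close> is nonzero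
      and is never moved, so both sides read only zero coefficients of \<open>G\<close>.\<close>
    have "pair_Deltas is (\<lambda>_. 0) m = 0" for "is"
      by (induction "is" arbitrary: m) (simp_all add: pair_Deltas_Nil pair_Deltas_Cons)
    moreover have "pair_Deltas [1..<k] (G k) m = pair_Deltas [1..<k] (\<lambda>_. 0) m"
      by (rule pair_Deltas_cong[where S = "{1..k}"]) (use False in \<open>auto simp: G_def keys_iff simp del: One_nat_def\<close>)
    moreover have "G k m1 = 0"
      using False by (auto simp: G_def keys_iff m1 simp del: One_nat_def)
    ultimately show ?thesis by simp
  qed
  then show "(compose_list (map Delta [1..<k + 1])
      - compose_list (map (\<lambda>i. Delta i + Delta (i + 1)) [1..<k])) (G k) m = 0 m"
    by (simp only: minus_apply lhs pair_Deltas_def) simp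
qed

end
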